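(* Let $\hat\sigma_1,\hat\sigma_2,\hat\sigma_3$ be the Pauli matrices, let $\alpha_1,\alpha_2,\alpha_3\in\mathbb{R}$, and let $$\Omega = e^{-i(\alpha_1\hat\sigma_1\otimes\hat\sigma_1+\alpha_2\hat\sigma_2\otimes\hat\sigma_2+\alpha_3\hat\sigma_3\otimes\hat\sigma_3)}.$$ Let $\mathcal{S}=\{n\pi/2 : n\in\{0,1,2,\dots\}\}$ and suppose exactly one of $\alpha_1,\alpha_2,\alpha_3$ lies in $\mathcal{S}$ (a "two-parameter family"). Let $U=(\mathcal{L}_1\otimes\mathcal{L}_2)\,\Omega\,(\mathcal{R}_1\otimes\mathcal{R}_2)$ for arbitrary single-qubit unitaries $\mathcal{L}_1,\mathcal{L}_2,\mathcal{R}_1,\mathcal{R}_2$. Then for every two-qubit density operator $\rho^{SE}$ on $\mathbb{C}^2_S\otimes\mathbb{C}^2_E$ there exist a single-qubit unitary $V$ acting on $S$ (whose induced rotation $\mathcal{O}_V\in SO(3)$ on the Bloch/correlation indices is a product of Givens rotations) and a single-qubit density operator $\zeta^E$ such that $$\operatorname{Tr}_E\big[U (V\otimes\mathbb{I})\rho^{SE}(V^\dagger\otimes\mathbb{I})U^\dagger\big]=\operatorname{Tr}_E\big[U\big(V\rho^S V^\dagger\otimes\zeta^E\big)U^\dagger\big],$$ where $\rho^S=\operatorname{Tr}_E\rho^{SE}$; i.e. after applying $V$ on the system, the system dynamics are $U$-generated by a product state.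
   Context: For a global two-qubit unitary $U$ and a joint state $\tau^{SE}$ with $\tau^S=\operatorname{Tr}_E\tau^{SE}$, the system dynamics $\tau^S\mapsto\operatorname{Tr}_E(U\tau^{SE}U^\dagger)$ are said to be $U$-generated by a product state if there is a valid single-qubit density operator $\zeta^E$ with $\operatorname{Tr}_E(U\tau^{SE}U^\dagger)=\operatorname{Tr}_E(U(\tau^S\otimes\zeta^E)U^\dagger)$. A local unitary $V$ on the system induces the orthogonal matrix $\mathcal{O}_{ij}=\tfrac12\operatorname{Tr}(\hat\sigma_i V\hat\sigma_j V^\dagger)$, which acts on the system Bloch vector and on the left of the correlation matrix $t_{ij}=\operatorname{Tr}(\rho^{SE}\hat\sigma_i\otimes\hat\sigma_j)$. A Givens rotation is a $3\times3$ rotation by an angle $\theta$ in a coordinate plane $(i,j)$: identity on the remaining coordinate, entries $\cos\theta$ at $(i,i),(j,j)$, and $\mp\sin\theta$ off-diagonal. *)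

theory Defs
  imports "HOL-Analysis.Analysis"
begin

text \<open>Single-qubit operators: complex^2^2. Two-qubit operators on C^2_S (x) C^2_E:
  complex^(2*2)^(2*2), the pair index (i,k) meaning |i>_S (x) |k>_E.\<close>

type_synonym qop = "complex^2^2"
type_synonym qqop = "complex^(2 \<times> 2)^(2 \<times> 2)"

definition adj :: "complex^'n^'m \<Rightarrow> complex^'m^'n" where
  "adj A = (\<chi> i j. cnj (A $ j $ i))"

definition unitary_op :: "complex^'n^'n \<Rightarrow> bool" where
  "unitary_op U \<longleftrightarrow> adj U ** U = mat 1 \<and> U ** adj U = mat 1"

text \<open>Density operator: positive semidefinite with unit trace.\<close>
definition density :: "complex^'n^'n \<Rightarrow> bool" where
  "density \<rho> \<longleftrightarrow>
     (\<forall>v :: complex^'n. Im (\<Sum>i\<in>UNIV. cnj (v $ i) * (\<rho> *v v) $ i) = 0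
                      \<and> 0 \<le> Re (\<Sum>i\<in>UNIV. cnj (v $ i) * (\<rho> *v v) $ i))
     \<and> trace \<rho> = 1"

text \<open>Kronecker (tensor) product and partial trace over E.\<close>
definition tensor :: "qop \<Rightarrow> qop \<Rightarrow> qqop" (infixr "\<otimes>\<^sub>q" 75) where
  "A \<otimes>\<^sub>q B = (\<chi> p q. A $ fst p $ fst q * B $ snd p $ snd q)"

definition ptrE :: "qqop \<Rightarrow> qop" where
  "ptrE M = (\<chi> i j. \<Sum>k\<in>UNIV. M $ (i, k) $ (j, k))"

text \<open>Pauli matrices sigma_1, sigma_2, sigma_3, indexed by the elements 0, 1, 2 of type 3;
  basis of C^2 indexed by 0, 1 of type 2.\<close>
definition sx :: qop where
  "sx = (\<chi> i j. if i = j then 0 else 1)"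
definition sy :: qop where
  "sy = (\<chi> i j. if i = j then 0 else if i = 0 then - \<i> else \<i>)"
definition sz :: qop where
  "sz = (\<chi> i j. if i = j then (if i = 0 then 1 else -1) else 0)"

definition pauli :: "3 \<Rightarrow> qop" where
  "pauli k = (if k = 0 then sx else if k = 1 then sy else sz)"

text \<open>Matrix powers and the matrix exponential (entrywise power series).\<close>
fun mpow :: "complex^'n^'n \<Rightarrow> nat \<Rightarrow> complex^'n^'n" where
  "mpow A 0 = mat 1"
| "mpow A (Suc k) = A ** mpow A k"

definition mexp :: "complex^'n^'n \<Rightarrow> complex^'n^'n" where
  "mexp A = (\<chi> i j. \<Sum>k. (mpow A k) $ i $ j / of_nat (fact k))"

text \<open>Omega = exp(-i(a1 s1(x)s1 + a2 s2(x)s2 + a3 s3(x)s3)).\<close>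
definition Omega :: "real \<Rightarrow> real \<Rightarrow> real \<Rightarrow> qqop" where
  "Omega a1 a2 a3 = mexp (\<chi> p q. - \<i> * (of_real a1 * (sx \<otimes>\<^sub>q sx) $ p $ q
                                        + of_real a2 * (sy \<otimes>\<^sub>q sy) $ p $ q
                                        + of_real a3 * (sz \<otimes>\<^sub>q sz) $ p $ q))"

definition Sset :: "real set" where
  "Sset = {real n * pi / 2 | n :: nat. True}"

text \<open>Induced rotation O_ij = 1/2 Tr(sigma_i V sigma_j V^dagger) (a real number).\<close>
definition bloch_rot :: "qop \<Rightarrow> real^3^3" where
  "bloch_rot V = (\<chi> i j. Re (trace (pauli i ** V ** pauli j ** adj V) / 2))"

text \<open>Givens rotation by angle th in the coordinate plane (i,j), i \<noteq> j.\<close>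
definition givens :: "3 \<Rightarrow> 3 \<Rightarrow> real \<Rightarrow> real^3^3" where
  "givens i j th = (\<chi> r c.
      if r = i \<and> c = i then cos th
      else if r = j \<and> c = j then cos th
      else if r = i \<and> c = j then - sin th
      else if r = j \<and> c = i then sin th
      else if r = c then 1 else 0)"

definition is_givens :: "real^3^3 \<Rightarrow> bool" where
  "is_givens G \<longleftrightarrow> (\<exists>i j th. i \<noteq> j \<and> G = givens i j th)"

definition product_of_givens :: "real^3^3 \<Rightarrow> bool" where
  "product_of_givens M \<longleftrightarrow>
     (\<exists>gs. list_all is_givens gs \<and> M = foldr (**) gs (mat 1))"

end

theory Submission
  imports Defs
begin

text \<open>
  Split \<rho> = \<rho>_S \<otimes> \<rho>_E + \<gamma>. The correlated part \<gamma> has vanishing partial traces, so it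
  is (1/4) \<Sigma> t_ij \<sigma>_i \<otimes> \<sigma>_j for its correlation matrix t, and it suffices to choose V
  with Tr_E [U (V \<otimes> 1) \<gamma> (V \<otimes> 1)\<dagger> U\<dagger>] = 0; then \<zeta> = \<rho>_E works.
  L_2 drops out under Tr_E, L_1 only conjugates the result and R_2 preserves the form of \<gamma>, while
  R_1 V rotates t into t' = O t with O = O_(R_1) O_V. A single-qubit Clifford unitary permutes
  the Pauli matrices cyclically, so we may assume sin (2 \<alpha>_3) = 0. Omega is diagonal in the
  Bell basis, and then only the components t'_20, t'_21, t'_01, t'_10 survive (indices 0, 1, 2
  as in pauli): it suffices that t'_20 = t'_21 = 0 and \<kappa>_01 t'_01 + \<kappa>_10 t'_10 = 0.
  These three equations are solved by a product of Givens rotations in the planes (0,1) and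
  (1,2), and each of those is induced by a single-qubit unitary.
\<close>

section \<open>Enumerating the index types 2 and 3\<close>

lemma sum_2_from_0: "sum f (UNIV::2 set) = f 0 + f 1"
proof -
  have "(2::2) = 0" by simp
  then show ?thesis using sum_2[of f] by (simp only:) (simp add: add.commute)
qed

lemma sum_3_from_0: "sum f (UNIV::3 set) = f 0 + f 1 + f 2"
proof -
  have "(3::3) = 0" by simp
  then show ?thesis using sum_3[of f] by (simp only:) (simp add: add_ac)
qed

lemma sum_2x2: "sum f (UNIV::(2\<times>2) set) = f (0,0) + f (0,1) + f (1,0) + f (1,1)"
proof -
  have "sum f (UNIV::(2\<times>2) set) = (\<Sum>a\<in>UNIV. \<Sum>b\<in>UNIV. f (a,b))"
    by (simp add: sum.cartesian_product)
  then show ?thesis by (simp add: sum_2_from_0 add_ac)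
qed

lemma forall_2_from_0: "(\<forall>i::2. P i) \<longleftrightarrow> P 0 \<and> P 1"
proof -
  have "(2::2) = 0" by simp
  then show ?thesis using forall_2[of P] by (simp only:) blast
qed

lemma forall_3_from_0: "(\<forall>i::3. P i) \<longleftrightarrow> P 0 \<and> P 1 \<and> P 2"
proof -
  have "(3::3) = 0" by simp
  then show ?thesis using forall_3[of P] by (simp only:) blast
qed

lemma forall_2x2: "(\<forall>i::2\<times>2. P i) \<longleftrightarrow> P (0,0) \<and> P (0,1) \<and> P (1,0) \<and> P (1,1)"
  by (simp only: split_paired_All forall_2_from_0 conj_assoc)

section \<open>Adjoints, unitaries and density operators\<close>

lemma matrix_add_rdistrib: "(A + B) ** C = A ** C + B ** (C :: 'a::semiring_1^_^_)"
  by (simp add: vec_eq_iff matrix_matrix_mult_def sum.distrib algebra_simps)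

lemma adj_adj [simp]: "adj (adj A) = A"
  by (simp add: vec_eq_iff adj_def)

lemma adj_mat_1 [simp]: "adj (mat 1 :: complex^'n^'n) = mat 1"
  by (simp add: vec_eq_iff adj_def mat_def)

lemma adj_matrix_mult: "adj ((A::complex^'n^'m) ** B) = adj B ** adj A"
  by (simp add: vec_eq_iff adj_def matrix_matrix_mult_def cnj_sum mult.commute)

lemma adj_diff: "adj (A - B) = adj A - adj B"
  by (simp add: vec_eq_iff adj_def)

lemma unitary_op_left: "unitary_op U \<Longrightarrow> adj U ** U = mat 1"
  by (simp add: unitary_op_def)

lemma unitary_op_adj: "unitary_op U \<Longrightarrow> unitary_op (adj U)"
  by (simp add: unitary_op_def)

lemma unitary_op_mult:
  assumes "unitary_op A" "unitary_op B"
  shows "unitary_op (A ** B)"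
proof -
  have "adj (A ** B) ** (A ** B) = adj B ** (adj A ** A) ** B"
    and "(A ** B) ** adj (A ** B) = A ** (B ** adj B) ** adj A"
    by (simp_all add: adj_matrix_mult matrix_mul_assoc)
  then show ?thesis using assms by (simp add: unitary_op_def)
qed

definition quad_form :: "complex^'n^'n \<Rightarrow> complex^'n \<Rightarrow> complex" where
  "quad_form M v = (\<Sum>i\<in>UNIV. cnj (v $ i) * (M *v v) $ i)"

lemma density_iff_quad_form:
  "density \<rho> \<longleftrightarrow> (\<forall>v. Im (quad_form \<rho> v) = 0 \<and> 0 \<le> Re (quad_form \<rho> v)) \<and> trace \<rho> = 1"
  by (simp add: density_def quad_form_def)

lemma matrix_vector_mult_axis: "((M::complex^'n^'n) *v axis a 1) $ i = M $ i $ a"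
  by (simp add: matrix_vector_mult_def axis_def mult.commute[of "M $ i $ _"]
      if_distrib[of "\<lambda>x. x * _"] cong: if_cong)

lemma sum_cnj_axis: "(\<Sum>i\<in>UNIV. cnj (axis a 1 $ i) * f i) = f a"
  by (simp add: axis_def if_distrib[of "\<lambda>x. cnj x * _"] cong: if_cong)

lemma quad_form_axis: "quad_form M (axis a 1) = M $ a $ a"
  by (simp add: quad_form_def matrix_vector_mult_axis sum_cnj_axis)

lemma quad_form_axis2:
  "quad_form M (axis a 1 + c *s axis b 1)
     = M $ a $ a + c * M $ a $ b + cnj c * M $ b $ a + cnj c * c * M $ b $ b"
  by (simp add: quad_form_def matrix_vector_right_distrib vector_scalar_commute
      matrix_vector_mult_axis distrib_left distrib_right sum.distrib sum_cnj_axis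
      mult.assoc flip: sum_distrib_left)

lemma density_adj:
  assumes "density \<rho>"
  shows "adj \<rho> = \<rho>"
proof -
  have real: "Im (quad_form \<rho> v) = 0" for v
    using assms by (simp add: density_iff_quad_form)
  have "cnj (\<rho> $ a $ b) = \<rho> $ b $ a" for a b
  proof -
    have pair: "Im (\<rho> $ a $ a + c * \<rho> $ a $ b + cnj c * \<rho> $ b $ a + cnj c * c * \<rho> $ b $ b) = 0"
      for c
      using real[of "axis a 1 + c *s axis b 1"] by (simp only: quad_form_axis2)
    have "Im (\<rho> $ a $ a) = 0" "Im (\<rho> $ b $ b) = 0"
      using real[of "axis a 1"] real[of "axis b 1"] by (simp_all only: quad_form_axis)
    moreover have "Im (\<rho> $ a $ a) + Im (\<rho> $ a $ b) + Im (\<rho> $ b $ a) + Im (\<rho> $ b $ b) = 0"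
      using pair[of 1] by simp
    moreover have "Im (\<rho> $ a $ a) + Re (\<rho> $ a $ b) - Re (\<rho> $ b $ a) + Im (\<rho> $ b $ b) = 0"
      using pair[of \<i>] by simp
    ultimately show ?thesis by (simp add: complex_eq_iff)
  qed
  then show ?thesis by (simp add: vec_eq_iff adj_def)
qed

section \<open>Tensor products and partial traces\<close>

definition ptrS :: "qqop \<Rightarrow> qop" where
  "ptrS M = (\<chi> k l. \<Sum>i\<in>UNIV. M $ (i, k) $ (i, l))"

lemma adj_tensor: "adj (A \<otimes>\<^sub>q B) = adj A \<otimes>\<^sub>q adj B"
  by (simp add: vec_eq_iff adj_def tensor_def)

lemma tensor_matrix_mult: "(A \<otimes>\<^sub>q B) ** (C \<otimes>\<^sub>q D) = (A ** C) \<otimes>\<^sub>q (B ** D)"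
  unfolding vec_eq_iff forall_2x2
  by (simp add: tensor_def matrix_matrix_mult_def sum_2x2 sum_2_from_0 algebra_simps)

lemma ptrE_add: "ptrE (A + B) = ptrE A + ptrE B"
  by (simp add: vec_eq_iff ptrE_def sum.distrib)

lemma ptrE_diff: "ptrE (A - B) = ptrE A - ptrE B"
  by (simp add: vec_eq_iff ptrE_def sum_subtractf)

lemma ptrS_diff: "ptrS (A - B) = ptrS A - ptrS B"
  by (simp add: vec_eq_iff ptrS_def sum_subtractf)

lemma adj_ptrE: "adj (ptrE M) = ptrE (adj M)"
  by (simp add: vec_eq_iff adj_def ptrE_def)

lemma adj_ptrS: "adj (ptrS M) = ptrS (adj M)"
  by (simp add: vec_eq_iff adj_def ptrS_def)

lemma trace_ptrE: "trace (ptrE M) = trace M"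
  by (simp add: trace_def ptrE_def sum_2x2 sum_2_from_0 algebra_simps)

lemma trace_ptrS: "trace (ptrS M) = trace M"
  by (simp add: trace_def ptrS_def sum_2x2 sum_2_from_0 algebra_simps)

lemma ptrE_tensor: "trace Z = 1 \<Longrightarrow> ptrE (X \<otimes>\<^sub>q Z) = X"
  by (simp add: vec_eq_iff ptrE_def tensor_def trace_def flip: sum_distrib_left)

lemma ptrS_tensor: "trace X = 1 \<Longrightarrow> ptrS (X \<otimes>\<^sub>q Z) = Z"
  by (simp add: vec_eq_iff ptrS_def tensor_def trace_def flip: sum_distrib_right)

lemma sum_unitary_column_products:
  assumes "adj B ** B = mat 1"
  shows "(\<Sum>k\<in>UNIV. B $ k $ l * cnj (B $ k $ m)) = (if l = m then 1 else 0)"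
proof -
  have "(adj B ** B) $ m $ l = mat 1 $ m $ l" using assms by simp
  then show ?thesis by (simp add: adj_def matrix_matrix_mult_def mat_def mult.commute eq_commute)
qed

lemma ptrE_tensor_conj:
  assumes "adj B ** B = mat 1"
  shows "ptrE ((A \<otimes>\<^sub>q B) ** M ** adj (A \<otimes>\<^sub>q B)) = A ** ptrE M ** adj A"
proof -
  have "ptrE ((A \<otimes>\<^sub>q B) ** M ** adj (A \<otimes>\<^sub>q B)) $ i $ j =
    (\<Sum>a\<in>UNIV. \<Sum>b\<in>UNIV. \<Sum>l\<in>UNIV. \<Sum>m\<in>UNIV.
       A $ i $ a * cnj (A $ j $ b) * M $ (a, l) $ (b, m) * (\<Sum>k\<in>UNIV. B $ k $ l * cnj (B $ k $ m)))"
    for i j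
    by (simp add: ptrE_def matrix_matrix_mult_def tensor_def adj_def sum_2x2 sum_2_from_0 algebra_simps)
  then show ?thesis
    unfolding vec_eq_iff sum_unitary_column_products[OF assms]
    by (simp add: ptrE_def matrix_matrix_mult_def adj_def sum_2_from_0 algebra_simps)
qed

lemma ptrS_tensor_conj:
  assumes "adj A ** A = mat 1"
  shows "ptrS ((A \<otimes>\<^sub>q B) ** M ** adj (A \<otimes>\<^sub>q B)) = B ** ptrS M ** adj B"
proof -
  have "ptrS ((A \<otimes>\<^sub>q B) ** M ** adj (A \<otimes>\<^sub>q B)) $ i $ j =
    (\<Sum>a\<in>UNIV. \<Sum>b\<in>UNIV. \<Sum>l\<in>UNIV. \<Sum>m\<in>UNIV.
       B $ i $ a * cnj (B $ j $ b) * M $ (l, a) $ (m, b) * (\<Sum>k\<in>UNIV. A $ k $ l * cnj (A $ k $ m)))"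
    for i j
    by (simp add: ptrS_def matrix_matrix_mult_def tensor_def adj_def sum_2x2 sum_2_from_0 algebra_simps)
  then show ?thesis
    unfolding vec_eq_iff sum_unitary_column_products[OF assms]
    by (simp add: ptrS_def matrix_matrix_mult_def adj_def sum_2_from_0 algebra_simps)
qed

lemma quad_form_ptrS:
  "quad_form (ptrS \<rho>) w
     = quad_form \<rho> (\<chi> x. if fst x = 0 then w $ snd x else 0)
     + quad_form \<rho> (\<chi> x. if fst x = 1 then w $ snd x else 0)"
  by (simp add: quad_form_def ptrS_def matrix_vector_mult_def sum_2x2 sum_2_from_0 algebra_simps)

lemma density_ptrS:
  assumes "density \<rho>"
  shows "density (ptrS \<rho>)"
  using assms
  by (simp add: density_iff_quad_form quad_form_ptrS trace_ptrS add_nonneg_nonneg)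

lemma ptrE_ptrS_correlated_part:
  assumes "trace \<rho> = 1"
  shows "ptrE (\<rho> - ptrE \<rho> \<otimes>\<^sub>q ptrS \<rho>) = 0"
    and "ptrS (\<rho> - ptrE \<rho> \<otimes>\<^sub>q ptrS \<rho>) = 0"
  using assms by (simp_all add: ptrE_diff ptrS_diff ptrE_tensor ptrS_tensor trace_ptrE trace_ptrS)

section \<open>Bell-diagonal operators and Omega\<close>

text \<open>In the basis |00>, |01>, |10>, |11>: diagonal (p, r, r, p), anti-diagonal (q, w, w, q).
  Such a matrix is diagonal in the Bell basis, with eigenvalue p \<plusminus> q on (|00> \<plusminus> |11>)/\<surd>2
  and r \<plusminus> w on (|01> \<plusminus> |10>)/\<surd>2; bell_diag lists these four eigenvalues.\<close>

definition xmat :: "complex \<Rightarrow> complex \<Rightarrow> complex \<Rightarrow> complex \<Rightarrow> qqop" where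
  "xmat p q r w = (\<chi> x y.
     if x = y then (if fst x = snd x then p else r)
     else if fst x \<noteq> fst y \<and> snd x \<noteq> snd y then (if fst x = snd x then q else w)
     else 0)"

definition bell_diag :: "complex \<Rightarrow> complex \<Rightarrow> complex \<Rightarrow> complex \<Rightarrow> qqop" where
  "bell_diag e1 e2 e3 e4 = (\<chi> x y.
     if x = y then (if fst x = snd x then (e1 + e2) / 2 else (e3 + e4) / 2)
     else if fst x \<noteq> fst y \<and> snd x \<noteq> snd y then
       (if fst x = snd x then (e1 - e2) / 2 else (e3 - e4) / 2)
     else 0)"

lemma bell_diag_eq_xmat:
  "bell_diag e1 e2 e3 e4 = xmat ((e1 + e2) / 2) ((e1 - e2) / 2) ((e3 + e4) / 2) ((e3 - e4) / 2)"
  by (simp add: bell_diag_def xmat_def)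

lemma bell_diag_mult:
  "bell_diag a1 a2 a3 a4 ** bell_diag b1 b2 b3 b4 = bell_diag (a1 * b1) (a2 * b2) (a3 * b3) (a4 * b4)"
  unfolding vec_eq_iff forall_2x2
  by (simp add: matrix_matrix_mult_def bell_diag_def sum_2x2 field_simps)

lemma mat_1_eq_bell_diag: "mat 1 = bell_diag 1 1 1 1"
  unfolding vec_eq_iff forall_2x2 by (simp add: mat_def bell_diag_def)

lemma mpow_bell_diag: "mpow (bell_diag e1 e2 e3 e4) k = bell_diag (e1 ^ k) (e2 ^ k) (e3 ^ k) (e4 ^ k)"
  by (induction k) (simp_all add: mat_1_eq_bell_diag bell_diag_mult)

lemma exp_sums_complex: "(\<lambda>k. x ^ k / fact k) sums exp (x::complex)"
  using exp_converges[of x] by (simp add: scaleR_conv_of_real field_simps)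

lemma suminf_exp_half_sum: "(\<Sum>k. (a ^ k + b ^ k) / (2 * fact k)) = (exp a + exp b) / (2::complex)"
proof -
  have "(\<lambda>k. (a ^ k / fact k + b ^ k / fact k) / 2) sums ((exp a + exp b) / 2)"
    by (intro sums_divide sums_add exp_sums_complex)
  moreover have "(\<lambda>k. (a ^ k / fact k + b ^ k / fact k) / 2) = (\<lambda>k. (a ^ k + b ^ k) / (2 * fact k))"
    by (simp add: fun_eq_iff field_simps)
  ultimately show ?thesis by (simp add: sums_iff)
qed

lemma suminf_exp_half_diff: "(\<Sum>k. (a ^ k - b ^ k) / (2 * fact k)) = (exp a - exp b) / (2::complex)"
proof -
  have "(\<lambda>k. (a ^ k / fact k - b ^ k / fact k) / 2) sums ((exp a - exp b) / 2)"
    by (intro sums_divide sums_diff exp_sums_complex)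
  moreover have "(\<lambda>k. (a ^ k / fact k - b ^ k / fact k) / 2) = (\<lambda>k. (a ^ k - b ^ k) / (2 * fact k))"
    by (simp add: fun_eq_iff field_simps)
  ultimately show ?thesis by (simp add: sums_iff)
qed

lemma mexp_bell_diag: "mexp (bell_diag e1 e2 e3 e4) = bell_diag (exp e1) (exp e2) (exp e3) (exp e4)"
proof -
  have "(\<Sum>k. bell_diag (e1 ^ k) (e2 ^ k) (e3 ^ k) (e4 ^ k) $ i $ j / fact k)
      = bell_diag (exp e1) (exp e2) (exp e3) (exp e4) $ i $ j" for i j
    by (auto simp: bell_diag_def suminf_exp_half_sum suminf_exp_half_diff)
  then show ?thesis by (simp add: vec_eq_iff mexp_def mpow_bell_diag)
qed

lemma Omega_generator_eq_bell_diag: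
  "(\<chi> p q. - \<i> * (of_real a1 * (sx \<otimes>\<^sub>q sx) $ p $ q + of_real a2 * (sy \<otimes>\<^sub>q sy) $ p $ q
                     + of_real a3 * (sz \<otimes>\<^sub>q sz) $ p $ q))
   = bell_diag (- \<i> * of_real (a3 + a1 - a2)) (- \<i> * of_real (a3 - a1 + a2))
               (- \<i> * of_real (a1 + a2 - a3)) (\<i> * of_real (a1 + a2 + a3))"
  unfolding vec_eq_iff forall_2x2
  by (simp add: bell_diag_def tensor_def sx_def sy_def sz_def field_simps)

lemma Omega_eq_bell_diag:
  "Omega a1 a2 a3 = bell_diag (cis (- (a3 + a1 - a2))) (cis (- (a3 - a1 + a2)))
                              (cis (- (a1 + a2 - a3))) (cis (a1 + a2 + a3))"
proof -
  have "exp (- \<i> * of_real x) = cis (- x)" "exp (\<i> * of_real x) = cis x" for x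
    by (simp_all add: cis_conv_exp)
  then show ?thesis
    by (simp only: Omega_def Omega_generator_eq_bell_diag mexp_bell_diag)
qed

text \<open>Conjugation by pauli_cycle maps sx \<mapsto> sy \<mapsto> sz \<mapsto> sx, so it permutes
  the parameters of Omega cyclically.\<close>

definition pauli_cycle :: qop where
  "pauli_cycle = (\<chi> i j. if i = 0 then (if j = 0 then (1 - \<i>) / 2 else (- 1 - \<i>) / 2)
                                  else (if j = 0 then (1 - \<i>) / 2 else (1 + \<i>) / 2))"

lemma unitary_pauli_cycle: "unitary_op pauli_cycle"
  unfolding unitary_op_def vec_eq_iff forall_2_from_0
  by (simp add: pauli_cycle_def adj_def matrix_matrix_mult_def mat_def sum_2_from_0 field_simps)

lemma Omega_cycle:
  "Omega a1 a2 a3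
     = (pauli_cycle \<otimes>\<^sub>q pauli_cycle) ** Omega a2 a3 a1 ** adj (pauli_cycle \<otimes>\<^sub>q pauli_cycle)"
proof -
  have "bell_diag e1 e2 e3 e4
      = (pauli_cycle \<otimes>\<^sub>q pauli_cycle) ** bell_diag e3 e1 e2 e4 ** adj (pauli_cycle \<otimes>\<^sub>q pauli_cycle)"
    for e1 e2 e3 e4
    unfolding vec_eq_iff forall_2x2
    by (simp add: matrix_matrix_mult_def bell_diag_def tensor_def adj_def pauli_cycle_def
        sum_2x2 field_simps)
  moreover have "a3 + a1 - a2 = a1 - a2 + a3" "a3 - a1 + a2 = a2 + a3 - a1" "a2 + a3 + a1 = a1 + a2 + a3"
    by simp_all
  ultimately show ?thesis
    unfolding Omega_eq_bell_diag by metis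
qed

lemma local_Omega_cycle:
  "(L1 \<otimes>\<^sub>q L2) ** Omega a1 a2 a3 ** (R1 \<otimes>\<^sub>q R2)
     = ((L1 ** pauli_cycle) \<otimes>\<^sub>q (L2 ** pauli_cycle)) ** Omega a2 a3 a1
       ** ((adj pauli_cycle ** R1) \<otimes>\<^sub>q (adj pauli_cycle ** R2))"
proof -
  have "(L1 \<otimes>\<^sub>q L2) ** Omega a1 a2 a3 ** (R1 \<otimes>\<^sub>q R2)
      = ((L1 \<otimes>\<^sub>q L2) ** (pauli_cycle \<otimes>\<^sub>q pauli_cycle)) ** Omega a2 a3 a1
        ** ((adj pauli_cycle \<otimes>\<^sub>q adj pauli_cycle) ** (R1 \<otimes>\<^sub>q R2))"
    by (subst Omega_cycle) (simp add: adj_tensor matrix_mul_assoc)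
  then show ?thesis by (simp only: tensor_matrix_mult)
qed



lemma Im_cnj_mult_eq_0_iff: "Im (cnj a * b) = 0 \<longleftrightarrow> cnj a * b = cnj b * a"
  by (simp add: complex_eq_iff algebra_simps)

lemma Omega_eq_xmat:
  assumes "sin (2 * a3) = 0"
  obtains p q r w where "Omega a1 a2 a3 = xmat p q r w"
    and "cnj p * q + cnj q * p = 0" and "cnj r * w + cnj w * r = 0"
    and "cnj p * p + cnj q * q = cnj r * r + cnj w * w"
    and "cnj p * r = cnj r * p" and "cnj q * w = cnj w * q"
proof -
  define e1 e2 e3 e4 where "e1 = cis (- (a3 + a1 - a2))" and "e2 = cis (- (a3 - a1 + a2))"
    and "e3 = cis (- (a1 + a2 - a3))" and "e4 = cis (a1 + a2 + a3)"
  have unit: "cnj e1 * e1 = 1" "cnj e2 * e2 = 1" "cnj e3 * e3 = 1" "cnj e4 * e4 = 1"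
    by (simp_all add: e1_def e2_def e3_def e4_def cis_cnj cis_mult)
  have phases: "cnj e1 * e3 = cis (2 * a3 - 2 * a2)" "cnj e1 * e4 = cis (2 * a3 + 2 * a1)"
    "cnj e2 * e3 = cis (2 * a3 - 2 * a1)" "cnj e2 * e4 = cis (2 * a3 + 2 * a2)"
    by (simp_all add: e1_def e2_def e3_def e4_def cis_cnj cis_mult algebra_simps)
  have "cnj (e1 + e2) * (e3 + e4) = cnj e1 * e3 + cnj e1 * e4 + cnj e2 * e3 + cnj e2 * e4"
    "cnj (e1 - e2) * (e3 - e4) = cnj e1 * e3 - cnj e1 * e4 - cnj e2 * e3 + cnj e2 * e4"
    by (simp_all add: algebra_simps)
  then have "Im (cnj (e1 + e2) * (e3 + e4)) = 0" "Im (cnj (e1 - e2) * (e3 - e4)) = 0"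
    using assms by (simp_all only: phases) (simp_all add: sin_add sin_diff)
  then have real: "cnj (e1 + e2) * (e3 + e4) = cnj (e3 + e4) * (e1 + e2)"
    "cnj (e1 - e2) * (e3 - e4) = cnj (e3 - e4) * (e1 - e2)"
    by (simp_all only: Im_cnj_mult_eq_0_iff)
  show ?thesis
  proof
    show "Omega a1 a2 a3 = xmat ((e1 + e2) / 2) ((e1 - e2) / 2) ((e3 + e4) / 2) ((e3 - e4) / 2)"
      by (simp add: Omega_eq_bell_diag bell_diag_eq_xmat e1_def e2_def e3_def e4_def)
    have quarter: "cnj (x / 2) * (y / 2) = cnj x * y / 4" for x y :: complex
      by simp
    show "cnj ((e1 + e2) / 2) * ((e3 + e4) / 2) = cnj ((e3 + e4) / 2) * ((e1 + e2) / 2)"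
      "cnj ((e1 - e2) / 2) * ((e3 - e4) / 2) = cnj ((e3 - e4) / 2) * ((e1 - e2) / 2)"
      unfolding quarter real by simp_all
  qed (use unit in \<open>simp_all add: field_simps\<close>)
qed

section \<open>Bloch rotations\<close>

lemma pauli_simps: "pauli 0 = sx" "pauli 1 = sy" "pauli 2 = sz"
  by (simp_all add: pauli_def)

lemmas pauli_entries = pauli_simps sx_def sy_def sz_def

lemma trace_pauli: "trace (pauli k) = 0"
proof -
  have "\<forall>k. trace (pauli k) = 0"
    unfolding forall_3_from_0 by (simp add: trace_def sum_2_from_0 pauli_entries)
  then show ?thesis by blast
qed

definition bloch_coeff :: "qop \<Rightarrow> 3 \<Rightarrow> 3 \<Rightarrow> complex" where
  "bloch_coeff A i k = trace (pauli i ** A ** pauli k ** adj A) / 2"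

lemma cnj_bloch_coeff: "cnj (bloch_coeff A i k) = bloch_coeff A i k"
proof -
  have "\<forall>i k. cnj (bloch_coeff A i k) = bloch_coeff A i k"
    unfolding forall_3_from_0
    by (simp add: bloch_coeff_def trace_def sum_2_from_0 matrix_matrix_mult_def adj_def
        pauli_entries algebra_simps)
  then show ?thesis by blast
qed

lemma bloch_coeff_eq_of_real: "bloch_coeff A i k = of_real (bloch_rot A $ i $ k)"
proof -
  have "bloch_coeff A i k \<in> \<real>"
    using cnj_bloch_coeff[of A i k] by (simp add: Reals_cnj_iff)
  then have "bloch_coeff A i k = of_real (Re (bloch_coeff A i k))"
    by (simp add: of_real_Re)
  then show ?thesis by (simp add: bloch_rot_def bloch_coeff_def)
qed

lemma bloch_coeff_mult_general:
  "bloch_coeff (A ** B) i j = (\<Sum>k\<in>UNIV. bloch_coeff A i k * bloch_coeff B k j)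
     + trace (B ** pauli j ** adj B) * trace (pauli i ** A ** adj A) / 4"
proof -
  have "\<forall>i j. bloch_coeff (A ** B) i j = (\<Sum>k\<in>UNIV. bloch_coeff A i k * bloch_coeff B k j)
     + trace (B ** pauli j ** adj B) * trace (pauli i ** A ** adj A) / 4"
    unfolding forall_3_from_0
    by (simp add: bloch_coeff_def trace_def sum_2_from_0 sum_3_from_0 matrix_matrix_mult_def
        adj_def pauli_entries field_simps)
  then show ?thesis by blast
qed

lemma bloch_coeff_mult:
  assumes "adj B ** B = mat 1"
  shows "bloch_coeff (A ** B) i j = (\<Sum>k\<in>UNIV. bloch_coeff A i k * bloch_coeff B k j)"
proof -
  have "trace (B ** pauli j ** adj B) = trace (pauli j ** (adj B ** B))"
    by (metis matrix_mul_assoc trace_mul_sym)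
  then show ?thesis
    using assms by (simp add: bloch_coeff_mult_general trace_pauli)
qed

lemma bloch_coeff_one: "bloch_coeff (mat 1) i j = (if i = j then 1 else 0)"
proof -
  have "\<forall>i j. bloch_coeff (mat 1) i j = (if i = j then 1 else 0)"
    unfolding forall_3_from_0
    by (simp add: bloch_coeff_def trace_def sum_2_from_0 matrix_matrix_mult_def adj_def mat_def
        pauli_entries)
  then show ?thesis by blast
qed

lemma bloch_coeff_adj: "bloch_coeff (adj A) i j = bloch_coeff A j i"
proof -
  have "\<forall>i j. bloch_coeff (adj A) i j = bloch_coeff A j i"
    unfolding forall_3_from_0
    by (simp add: bloch_coeff_def trace_def sum_2_from_0 matrix_matrix_mult_def adj_def
        pauli_entries algebra_simps)
  then show ?thesis by blast
qed

lemma real_matrix_eqI: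
  fixes X Y :: "real^'n^'m"
  assumes "\<And>i j. (of_real (X $ i $ j) :: complex) = of_real (Y $ i $ j)"
  shows "X = Y"
  using assms by (simp add: vec_eq_iff)

lemma bloch_rot_mult:
  assumes "adj B ** B = mat 1"
  shows "bloch_rot (A ** B) = bloch_rot A ** bloch_rot B"
  by (rule real_matrix_eqI)
    (simp add: bloch_coeff_eq_of_real[symmetric] bloch_coeff_mult[OF assms]
      matrix_matrix_mult_def[of "bloch_rot A"])

lemma bloch_rot_one: "bloch_rot (mat 1) = mat 1"
  by (rule real_matrix_eqI) (simp add: bloch_coeff_eq_of_real[symmetric] bloch_coeff_one, simp add: mat_def)

lemma bloch_rot_adj: "bloch_rot (adj A) = transpose (bloch_rot A)"
  by (rule real_matrix_eqI)
    (simp add: bloch_coeff_eq_of_real[symmetric] bloch_coeff_adj transpose_def)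

lemma bloch_rot_orthogonal:
  assumes "unitary_op A"
  shows "bloch_rot A ** transpose (bloch_rot A) = mat 1"
proof -
  have "bloch_rot (A ** adj A) = bloch_rot A ** bloch_rot (adj A)"
    using assms by (intro bloch_rot_mult) (simp add: unitary_op_def)
  with assms show ?thesis by (simp add: unitary_op_def bloch_rot_one bloch_rot_adj)
qed

section \<open>Correlation matrices\<close>

text \<open>The correlation matrix t_ij = Tr (Y (\<sigma>_i \<otimes> \<sigma>_j)).\<close>

definition corr :: "qqop \<Rightarrow> 3 \<Rightarrow> 3 \<Rightarrow> complex" where
  "corr Y i j = (\<Sum>p\<in>UNIV. \<Sum>q\<in>UNIV. Y $ p $ q * (pauli i \<otimes>\<^sub>q pauli j) $ q $ p)"

lemma ptrS_eq_0_entries: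
  assumes "ptrS Y = 0"
  shows "Y $ (1,0) $ (1,0) = - Y $ (0,0) $ (0,0)" "Y $ (1,0) $ (1,1) = - Y $ (0,0) $ (0,1)"
    "Y $ (1,1) $ (1,0) = - Y $ (0,1) $ (0,0)" "Y $ (1,1) $ (1,1) = - Y $ (0,1) $ (0,1)"
proof -
  have "ptrS Y $ k $ l = 0" for k l using assms by simp
  from this[of 0 0] this[of 0 1] this[of 1 0] this[of 1 1] show
    "Y $ (1,0) $ (1,0) = - Y $ (0,0) $ (0,0)" "Y $ (1,0) $ (1,1) = - Y $ (0,0) $ (0,1)"
    "Y $ (1,1) $ (1,0) = - Y $ (0,1) $ (0,0)" "Y $ (1,1) $ (1,1) = - Y $ (0,1) $ (0,1)"
    by (simp_all add: ptrS_def sum_2_from_0 eq_neg_iff_add_eq_0 add.commute)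
qed

lemma ptrE_eq_0_entries:
  assumes "ptrE Y = 0"
  shows "Y $ (0,1) $ (0,1) = - Y $ (0,0) $ (0,0)" "Y $ (0,1) $ (1,1) = - Y $ (0,0) $ (1,0)"
    "Y $ (1,1) $ (0,1) = - Y $ (1,0) $ (0,0)" "Y $ (1,1) $ (1,1) = - Y $ (1,0) $ (1,0)"
proof -
  have "ptrE Y $ k $ l = 0" for k l using assms by simp
  from this[of 0 0] this[of 0 1] this[of 1 0] this[of 1 1] show
    "Y $ (0,1) $ (0,1) = - Y $ (0,0) $ (0,0)" "Y $ (0,1) $ (1,1) = - Y $ (0,0) $ (1,0)"
    "Y $ (1,1) $ (0,1) = - Y $ (1,0) $ (0,0)" "Y $ (1,1) $ (1,1) = - Y $ (1,0) $ (1,0)"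
    by (simp_all add: ptrE_def sum_2_from_0 eq_neg_iff_add_eq_0 add.commute)
qed

lemma corr_tensor_conj:
  assumes "ptrS Y = 0"
  shows "corr ((A \<otimes>\<^sub>q mat 1) ** Y ** adj (A \<otimes>\<^sub>q mat 1)) i j
       = (\<Sum>k\<in>UNIV. bloch_coeff A i k * corr Y k j)"
proof -
  note entries = ptrS_eq_0_entries[OF assms]
  have "\<forall>i j. corr ((A \<otimes>\<^sub>q mat 1) ** Y ** adj (A \<otimes>\<^sub>q mat 1)) i j
       = (\<Sum>k\<in>UNIV. bloch_coeff A i k * corr Y k j)"
    unfolding forall_3_from_0
    by (simp add: corr_def bloch_coeff_def trace_def sum_2_from_0 sum_3_from_0 sum_2x2
        matrix_matrix_mult_def adj_def tensor_def mat_def pauli_entries entries field_simps)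
  then show ?thesis by blast
qed

lemma corr_adj: "corr (adj Y) i j = cnj (corr Y i j)"
proof -
  have "\<forall>i j. corr (adj Y) i j = cnj (corr Y i j)"
    unfolding forall_3_from_0 by (simp add: corr_def sum_2x2 tensor_def adj_def pauli_entries algebra_simps)
  then show ?thesis by blast
qed

lemma of_real_Re_corr:
  assumes "adj Y = Y"
  shows "of_real (Re (corr Y i j)) = corr Y i j"
  using corr_adj[of Y i j] assms by (metis Reals_cnj_iff of_real_Re)

lemma corr_tensor_conj_real:
  assumes "ptrS Y = 0" and "adj Y = Y"
  shows "corr ((A \<otimes>\<^sub>q mat 1) ** Y ** adj (A \<otimes>\<^sub>q mat 1)) i j
       = of_real ((bloch_rot A ** (\<chi> k l. Re (corr Y k l))) $ i $ j)"
proof -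
  have "corr ((A \<otimes>\<^sub>q mat 1) ** Y ** adj (A \<otimes>\<^sub>q mat 1)) i j
      = (\<Sum>k\<in>UNIV. bloch_coeff A i k * corr Y k j)"
    by (rule corr_tensor_conj[OF assms(1)])
  also have "\<dots> = (\<Sum>k\<in>UNIV. of_real (bloch_rot A $ i $ k) * of_real (Re (corr Y k j)))"
    by (simp add: bloch_coeff_eq_of_real of_real_Re_corr[OF assms(2)])
  also have "\<dots> = of_real ((bloch_rot A ** (\<chi> k l. Re (corr Y k l))) $ i $ j)"
    by (simp add: matrix_matrix_mult_def)
  finally show ?thesis .
qed

definition xmat_response :: "complex \<Rightarrow> complex \<Rightarrow> complex \<Rightarrow> complex \<Rightarrow> 3 \<Rightarrow> 3 \<Rightarrow> qop" where
  "xmat_response p q r w i j = ptrE (xmat p q r w ** (pauli i \<otimes>\<^sub>q pauli j) ** adj (xmat p q r w))"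

text \<open>An operator Y with vanishing marginals is (1/4) \<Sigma> t_ij \<sigma>_i \<otimes> \<sigma>_j with t = corr Y.\<close>

lemma ptrE_xmat_conj_expansion:
  assumes "ptrE Y = 0" and "ptrS Y = 0"
  shows "ptrE (xmat p q r w ** Y ** adj (xmat p q r w)) $ a $ b
       = (\<Sum>i\<in>UNIV. \<Sum>j\<in>UNIV. corr Y i j * xmat_response p q r w i j $ a $ b) / 4"
proof -
  note entries = ptrE_eq_0_entries[OF assms(1)] ptrS_eq_0_entries[OF assms(2)]
  have "\<forall>a b. ptrE (xmat p q r w ** Y ** adj (xmat p q r w)) $ a $ b
       = (\<Sum>i\<in>UNIV. \<Sum>j\<in>UNIV. corr Y i j * xmat_response p q r w i j $ a $ b) / 4"
    unfolding corr_def xmat_response_def forall_2_from_0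
    by (simp add: sum_3_from_0 sum_2x2 sum_2_from_0 pauli_entries ptrE_def xmat_def tensor_def
        adj_def matrix_matrix_mult_def entries algebra_simps)
  then show ?thesis by blast
qed

lemmas xmat_response_unfold = xmat_response_def sum_2x2 sum_2_from_0 pauli_entries ptrE_def
  xmat_def tensor_def adj_def matrix_matrix_mult_def

lemma xmat_response_00: "xmat_response p q r w 0 0
   = (\<chi> a b. if a = b then cnj p * q + cnj q * p + (cnj r * w + cnj w * r) else 0)"
  unfolding vec_eq_iff forall_2_from_0 by (simp add: xmat_response_unfold algebra_simps)

lemma xmat_response_11: "xmat_response p q r w 1 1
   = (\<chi> a b. if a = b then (cnj r * w + cnj w * r) - (cnj p * q + cnj q * p) else 0)"
  unfolding vec_eq_iff forall_2_from_0 by (simp add: xmat_response_unfold algebra_simps)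

lemma xmat_response_22: "xmat_response p q r w 2 2
   = (\<chi> a b. if a = b then (cnj p * p + cnj q * q) - (cnj r * r + cnj w * w) else 0)"
  unfolding vec_eq_iff forall_2_from_0 by (simp add: xmat_response_unfold algebra_simps)

lemma xmat_response_02: "xmat_response p q r w 0 2
   = (\<chi> a b. if a = b then 0
             else if a = 0 then (cnj r * p - cnj p * r) + (cnj q * w - cnj w * q)
             else - ((cnj r * p - cnj p * r) + (cnj q * w - cnj w * q)))"
  unfolding vec_eq_iff forall_2_from_0 by (simp add: xmat_response_unfold algebra_simps)

lemma xmat_response_12: "xmat_response p q r w 1 2
   = (\<chi> a b. if a = b then 0 else \<i> * (cnj p * r - cnj r * p) + \<i> * (cnj q * w - cnj w * q))"
  unfolding vec_eq_iff forall_2_from_0 by (simp add: xmat_response_unfold algebra_simps)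

definition kappa01 :: "complex \<Rightarrow> complex \<Rightarrow> complex \<Rightarrow> complex \<Rightarrow> complex" where
  "kappa01 p q r w = \<i> * (cnj p * q - cnj q * p) - \<i> * (cnj r * w - cnj w * r)"

definition kappa10 :: "complex \<Rightarrow> complex \<Rightarrow> complex \<Rightarrow> complex \<Rightarrow> complex" where
  "kappa10 p q r w = \<i> * (cnj p * q - cnj q * p) + \<i> * (cnj r * w - cnj w * r)"

lemma xmat_response_01: "xmat_response p q r w 0 1
   = (\<chi> a b. if a = b then (if a = 0 then kappa01 p q r w else - kappa01 p q r w) else 0)"
  unfolding vec_eq_iff forall_2_from_0 by (simp add: xmat_response_unfold kappa01_def algebra_simps)

lemma xmat_response_10: "xmat_response p q r w 1 0
   = (\<chi> a b. if a = b then (if a = 0 then kappa10 p q r w else - kappa10 p q r w) else 0)"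
  unfolding vec_eq_iff forall_2_from_0 by (simp add: xmat_response_unfold kappa10_def algebra_simps)

lemma kappa01_real: "kappa01 p q r w = of_real (Re (kappa01 p q r w))"
  by (simp add: kappa01_def complex_eq_iff)

lemma kappa10_real: "kappa10 p q r w = of_real (Re (kappa10 p q r w))"
  by (simp add: kappa10_def complex_eq_iff)

lemma ptrE_xmat_conj_eq_0:
  assumes "ptrE Y = 0" and "ptrS Y = 0"
    and "cnj p * q + cnj q * p = 0" and "cnj r * w + cnj w * r = 0"
    and "cnj p * p + cnj q * q = cnj r * r + cnj w * w"
    and "cnj p * r = cnj r * p" and "cnj q * w = cnj w * q"
    and "corr Y 2 0 = 0" and "corr Y 2 1 = 0"
    and kappa: "kappa01 p q r w * corr Y 0 1 + kappa10 p q r w * corr Y 1 0 = 0"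
  shows "ptrE (xmat p q r w ** Y ** adj (xmat p q r w)) = 0"
proof -
  have "xmat_response p q r w 0 0 = 0" "xmat_response p q r w 1 1 = 0"
    "xmat_response p q r w 2 2 = 0" "xmat_response p q r w 0 2 = 0" "xmat_response p q r w 1 2 = 0"
    unfolding xmat_response_00 xmat_response_11 xmat_response_22 xmat_response_02 xmat_response_12
    using assms(3-7) by (simp_all add: vec_eq_iff)
  moreover have "corr Y 0 1 * kappa01 p q r w = - (corr Y 1 0 * kappa10 p q r w)"
    using kappa by (simp add: mult.commute eq_neg_iff_add_eq_0)
  ultimately have "ptrE (xmat p q r w ** Y ** adj (xmat p q r w)) $ a $ b = 0" for a b
    unfolding ptrE_xmat_conj_expansion[OF assms(1,2)] sum_3_from_0
    using assms(8,9) by (simp add: xmat_response_01 xmat_response_10 algebra_simps)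
  then show ?thesis by (simp add: vec_eq_iff)
qed

section \<open>Givens rotations\<close>

lemma exists_angle_cos_sin_eq_0: "\<exists>t. a * cos t + b * sin t = (0::real)"
proof -
  obtain r t where "b = r * cos t" "- a = r * sin t" using polar_Ex by blast
  then have "a = - (r * sin t)" "b = r * cos t" by simp_all
  then have "a * cos t + b * sin t = 0" by (simp add: algebra_simps)
  then show ?thesis by blast
qed

lemma givens_01_mult_vec: "givens 0 1 t *v x
   = (\<chi> i. if i = 0 then cos t * x $ 0 - sin t * x $ 1
           else if i = 1 then sin t * x $ 0 + cos t * x $ 1 else x $ 2)"
  unfolding vec_eq_iff forall_3_from_0 by (simp add: givens_def matrix_vector_mult_def sum_3_from_0)

lemma givens_12_mult_vec: "givens 1 2 t *v x
   = (\<chi> i. if i = 0 then x $ 0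
           else if i = 1 then cos t * x $ 1 - sin t * x $ 2 else sin t * x $ 1 + cos t * x $ 2)"
  unfolding vec_eq_iff forall_3_from_0 by (simp add: givens_def matrix_vector_mult_def sum_3_from_0)

lemma transpose_givens_01: "transpose (givens 0 1 t) = givens 0 1 (- t)"
  unfolding vec_eq_iff forall_3_from_0 by (simp add: givens_def transpose_def)

lemma transpose_givens_12: "transpose (givens 1 2 t) = givens 1 2 (- t)"
  unfolding vec_eq_iff forall_3_from_0 by (simp add: givens_def transpose_def)

lemma sin_mult_sin:
  shows "sin t * sin t = 1 - cos t * cos (t::real)"
    and "sin t * (sin t * x) = (1 - cos t * cos t) * x"
proof -
  show sin2: "sin t * sin t = 1 - cos t * cos t"
    using sin_cos_squared_add3[of t] by (simp add: algebra_simps)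
  show "sin t * (sin t * x) = (1 - cos t * cos t) * x"
    by (simp add: mult.assoc[symmetric] sin2)
qed

lemma givens_01_orthogonal: "transpose (givens 0 1 t) ** givens 0 1 t = mat 1"
  unfolding vec_eq_iff forall_3_from_0
  by (simp add: givens_def transpose_def matrix_matrix_mult_def mat_def sum_3_from_0 sin_mult_sin
      algebra_simps)

lemma givens_12_orthogonal: "transpose (givens 1 2 t) ** givens 1 2 t = mat 1"
  unfolding vec_eq_iff forall_3_from_0
  by (simp add: givens_def transpose_def matrix_matrix_mult_def mat_def sum_3_from_0 sin_mult_sin
      algebra_simps)

inductive givens_word :: "real^3^3 \<Rightarrow> bool" where
  givens_word_one: "givens_word (mat 1)"
| givens_word_01: "givens_word G \<Longrightarrow> givens_word (givens 0 1 t ** G)"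
| givens_word_12: "givens_word G \<Longrightarrow> givens_word (givens 1 2 t ** G)"

lemma givens_word_mult: "givens_word G \<Longrightarrow> givens_word H \<Longrightarrow> givens_word (G ** H)"
  by (induction rule: givens_word.induct) (simp_all add: givens_word.intros flip: matrix_mul_assoc)

lemma givens_word_givens_01: "givens_word (givens 0 1 t)"
  using givens_word_01[OF givens_word_one] by simp

lemma givens_word_givens_12: "givens_word (givens 1 2 t)"
  using givens_word_12[OF givens_word_one] by simp

lemmas givens_word_intros = givens_word_mult givens_word_givens_01 givens_word_givens_12

lemma product_of_givens_givens_word: "givens_word G \<Longrightarrow> product_of_givens G"
proof (induction rule: givens_word.induct)
  case givens_word_one
  show ?case unfolding product_of_givens_def by (rule exI[of _ "[]"]) simp
next
  case (givens_word_01 G t)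
  then obtain gs where "list_all is_givens gs" "G = foldr (**) gs (mat 1)"
    unfolding product_of_givens_def by blast
  moreover have "is_givens (givens 0 1 t)" unfolding is_givens_def by force
  ultimately show ?case
    unfolding product_of_givens_def by (intro exI[of _ "givens 0 1 t # gs"]) simp
next
  case (givens_word_12 G t)
  then obtain gs where "list_all is_givens gs" "G = foldr (**) gs (mat 1)"
    unfolding product_of_givens_def by blast
  moreover have "is_givens (givens 1 2 t)" unfolding is_givens_def by force
  ultimately show ?case
    unfolding product_of_givens_def by (intro exI[of _ "givens 1 2 t # gs"]) simp
qed

lemma exists_givens_to_axis_2:
  assumes "(x $ 0)\<^sup>2 + (x $ 1)\<^sup>2 + (x $ 2)\<^sup>2 = 1"
  obtains t1 t2 where "(givens 1 2 t2 ** givens 0 1 t1) *v x = axis 2 1"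
proof -
  obtain r t1 where polar: "x $ 1 = r * cos t1" "x $ 0 = r * sin t1" using polar_Ex by blast
  define y where "y = givens 0 1 t1 *v x"
  have y: "y $ 0 = 0" "y $ 1 = r" "y $ 2 = x $ 2"
    unfolding y_def givens_01_mult_vec using polar sin_cos_squared_add[of t1]
    by (simp_all add: algebra_simps flip: distrib_left power2_eq_square)
  have "(x $ 2)\<^sup>2 + r\<^sup>2 = 1"
    using assms polar sin_cos_squared_add[of t1]
    by (simp add: power_mult_distrib algebra_simps flip: distrib_left)
  then obtain t2 where t2: "x $ 2 = cos t2" "r = sin t2" by (rule sincos_total_2pi)
  have "givens 1 2 t2 *v y = axis 2 1"
    unfolding givens_12_mult_vec vec_eq_iff forall_3_from_0 using y t2 sin_cos_squared_add[of t2]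
    by (simp add: axis_def power2_eq_square algebra_simps)
  then show ?thesis
    using that[of t2 t1] unfolding y_def by (simp add: matrix_vector_mul_assoc)
qed

lemma exists_givens_word_fixing_axis_2:
  fixes N :: "real^3^3"
  assumes orth: "N ** transpose N = mat 1"
  obtains H where "givens_word H"
    and "\<And>j. (N ** H) $ 2 $ j = (if j = 2 then 1 else 0)"
    and "\<And>i. (N ** H) $ i $ 2 = (if i = 2 then 1 else 0)"
proof -
  define n where "n = N $ 2"
  have "(N ** transpose N) $ 2 $ 2 = 1" using orth by (simp add: mat_def)
  then have "(n $ 0)\<^sup>2 + (n $ 1)\<^sup>2 + (n $ 2)\<^sup>2 = 1"
    by (simp add: n_def matrix_matrix_mult_def transpose_def sum_3_from_0 power2_eq_square)
  then obtain t1 t2 where Bn: "(givens 1 2 t2 ** givens 0 1 t1) *v n = axis 2 1"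
    by (rule exists_givens_to_axis_2)
  define B where "B = givens 1 2 t2 ** givens 0 1 t1"
  have "transpose B ** B
      = transpose (givens 0 1 t1) ** (transpose (givens 1 2 t2) ** givens 1 2 t2) ** givens 0 1 t1"
    by (simp add: B_def matrix_transpose_mul matrix_mul_assoc)
  also have "\<dots> = mat 1" by (simp add: givens_12_orthogonal givens_01_orthogonal)
  finally have "transpose B *v (B *v n) = n"
    by (simp only: matrix_vector_mul_assoc matrix_vector_mul_lid)
  then have "transpose B *v axis 2 1 = n"
    using Bn by (simp only: B_def)
  then have row_B: "B $ 2 $ k = n $ k" for k
    unfolding vec_eq_iff matrix_vector_mult_def transpose_def
    by (simp add: axis_def sum_3_from_0)
  show ?thesis
  proof
    show "givens_word (transpose B)"
      by (simp add: B_def matrix_transpose_mul transpose_givens_01 transpose_givens_12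
          givens_word_intros)
    show "(N ** transpose B) $ 2 $ j = (if j = 2 then 1 else 0)" for j
    proof -
      have "(N ** transpose B) $ 2 $ j = (B *v n) $ j"
        by (simp add: n_def matrix_matrix_mult_def matrix_vector_mult_def transpose_def mult.commute)
      then show ?thesis using Bn by (simp add: B_def axis_def)
    qed
    show "(N ** transpose B) $ i $ 2 = (if i = 2 then 1 else 0)" for i
    proof -
      have "(N ** transpose B) $ i $ 2 = (N ** transpose N) $ i $ 2"
        by (simp add: matrix_matrix_mult_def transpose_def row_B n_def)
      then show ?thesis using orth by (simp add: mat_def)
    qed
  qed
qed

lemma exists_givens_word_clearing_row_2:
  fixes C :: "real^3^3"
  obtains A where "givens_word A" and "(A ** C) $ 2 $ 0 = 0" and "(A ** C) $ 2 $ 1 = 0"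
proof -
  define c0 c1 where "c0 = column 0 C" and "c1 = column 1 C"
  obtain ta where ta: "(givens 1 2 ta *v c0) $ 2 = 0"
    using exists_angle_cos_sin_eq_0[of "c0 $ 2" "c0 $ 1"]
    by (auto simp: givens_12_mult_vec algebra_simps)
  define v where "v = givens 1 2 ta *v c0"
  obtain tb where "v $ 1 * cos tb + v $ 0 * sin tb = 0"
    using exists_angle_cos_sin_eq_0 by blast
  then have tb: "(givens 0 1 tb *v v) $ 1 = 0"
    by (simp add: givens_01_mult_vec algebra_simps)
  define u where "u = givens 0 1 tb *v (givens 1 2 ta *v c1)"
  obtain tc where "u $ 2 * cos tc + u $ 1 * sin tc = 0"
    using exists_angle_cos_sin_eq_0 by blast
  then have tc: "(givens 1 2 tc *v u) $ 2 = 0"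
    by (simp add: givens_12_mult_vec algebra_simps)
  define A where "A = givens 1 2 tc ** givens 0 1 tb ** givens 1 2 ta"
  have column_A: "(A ** C) $ 2 $ j = (A *v column j C) $ 2" for j
    by (simp add: matrix_matrix_mult_def matrix_vector_mult_def column_def)
  show ?thesis
  proof
    show "givens_word A" by (simp add: A_def givens_word_intros)
    have "(givens 0 1 tb *v v) $ 2 = 0"
      using ta by (simp add: v_def givens_01_mult_vec)
    with tb show "(A ** C) $ 2 $ 0 = 0"
      unfolding column_A by (simp add: A_def v_def c0_def givens_12_mult_vec[of tc]
          matrix_vector_mul_assoc[symmetric])
    show "(A ** C) $ 2 $ 1 = 0"
      using tc unfolding column_A by (simp add: A_def u_def c1_def matrix_vector_mul_assoc[symmetric])
  qed
qed

text \<open>H makes N H fix the axis 2 (as row and column), A clears row 2 of C in columns 0 and 1;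
  a rotation in the (0,1)-plane between them keeps both properties and solves the remaining
  linear equation.\<close>

lemma exists_givens_word_correlation_form:
  fixes N C :: "real^3^3" and k1 k2 :: real
  assumes "N ** transpose N = mat 1"
  obtains G where "givens_word G"
    and "(N ** G ** C) $ 2 $ 0 = 0" and "(N ** G ** C) $ 2 $ 1 = 0"
    and "k1 * (N ** G ** C) $ 0 $ 1 + k2 * (N ** G ** C) $ 1 $ 0 = 0"
proof -
  obtain H where H: "givens_word H"
    and row_K: "\<And>j. (N ** H) $ 2 $ j = (if j = 2 then 1 else 0)"
    and col_K: "\<And>i. (N ** H) $ i $ 2 = (if i = 2 then 1 else 0)"
    using exists_givens_word_fixing_axis_2[OF assms] by blast
  obtain A where A: "givens_word A" and D20: "(A ** C) $ 2 $ 0 = 0" and D21: "(A ** C) $ 2 $ 1 = 0"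
    by (rule exists_givens_word_clearing_row_2)
  define K D where "K = N ** H" and "D = A ** C"
  define X where "X = k1 * (K$0$0 * D$0$1 + K$0$1 * D$1$1) + k2 * (K$1$0 * D$0$0 + K$1$1 * D$1$0)"
  define Y where "Y = k1 * (K$0$1 * D$0$1 - K$0$0 * D$1$1) + k2 * (K$1$1 * D$0$0 - K$1$0 * D$1$0)"
  obtain th where th: "X * cos th + Y * sin th = 0" using exists_angle_cos_sin_eq_0 by blast
  define G where "G = H ** givens 0 1 th ** A"
  have "N ** G ** C = K ** givens 0 1 th ** D"
    by (simp add: G_def K_def D_def matrix_mul_assoc)
  then have M: "(N ** G ** C) $ i $ j
      = (\<Sum>a\<in>UNIV. K $ i $ a * (\<Sum>b\<in>UNIV. givens 0 1 th $ a $ b * D $ b $ j))" for i j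
    by (simp add: matrix_matrix_mult_def sum_distrib_right sum_distrib_left mult.assoc)
      (rule sum.swap)
  show ?thesis
  proof
    show "givens_word G" by (simp add: G_def H A givens_word_intros)
    show "(N ** G ** C) $ 2 $ 0 = 0" "(N ** G ** C) $ 2 $ 1 = 0"
      unfolding M using row_K D20 D21 by (simp_all add: K_def D_def sum_3_from_0 givens_def)
    show "k1 * (N ** G ** C) $ 0 $ 1 + k2 * (N ** G ** C) $ 1 $ 0 = 0"
      unfolding M using col_K th by (simp add: K_def X_def Y_def sum_3_from_0 givens_def algebra_simps)
  qed
qed

section \<open>Givens rotations induced by single-qubit unitaries\<close>

text \<open>zrot t = exp (- i t sz) and xrot t = exp (- i t sx).\<close>

definition zrot :: "real \<Rightarrow> qop" where
  "zrot t = (\<chi> i j. if i = j then (if i = 0 then cis (- t) else cis t) else 0)"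

definition xrot :: "real \<Rightarrow> qop" where
  "xrot t = (\<chi> i j. if i = j then complex_of_real (cos t) else - \<i> * complex_of_real (sin t))"

lemma unitary_zrot: "unitary_op (zrot t)"
  unfolding unitary_op_def vec_eq_iff forall_2_from_0
  by (simp add: zrot_def adj_def matrix_matrix_mult_def mat_def sum_2_from_0 cis_cnj cis_mult)

lemma unitary_xrot: "unitary_op (xrot t)"
proof -
  have "(complex_of_real (cos t))\<^sup>2 + (complex_of_real (sin t))\<^sup>2 = 1"
    by (simp flip: of_real_power of_real_add)
  then show ?thesis
    unfolding unitary_op_def vec_eq_iff forall_2_from_0
    by (simp add: xrot_def adj_def matrix_matrix_mult_def mat_def sum_2_from_0 algebra_simps
        flip: of_real_mult of_real_add power2_eq_square)
qed

lemma cos_sin_double: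
  shows "cos (2 * (t::real)) = cos t * cos t - sin t * sin t" and "sin (2 * t) = 2 * sin t * cos t"
  by (simp_all add: cos_double sin_double power2_eq_square)

lemma bloch_rot_zrot: "bloch_rot (zrot t) = givens 0 1 (2 * t)"
  unfolding vec_eq_iff forall_3_from_0 givens_def cos_sin_double
  by (simp add: bloch_rot_def zrot_def trace_def sum_2_from_0 matrix_matrix_mult_def adj_def
      pauli_entries sin_mult_sin field_simps)

lemma bloch_rot_xrot: "bloch_rot (xrot t) = givens 1 2 (2 * t)"
  unfolding vec_eq_iff forall_3_from_0 givens_def cos_sin_double
  by (simp add: bloch_rot_def xrot_def trace_def sum_2_from_0 matrix_matrix_mult_def adj_def
      pauli_entries sin_mult_sin field_simps)

lemma givens_word_realized:
  assumes "givens_word G"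
  obtains V where "unitary_op V" and "bloch_rot V = G"
  using assms
proof (induction arbitrary: thesis rule: givens_word.induct)
  case givens_word_one
  then show ?case by (metis bloch_rot_one unitary_op_def adj_mat_1 matrix_mul_lid)
next
  case (givens_word_01 G t)
  then obtain V where "unitary_op V" "bloch_rot V = G" by blast
  then show ?case
    using givens_word_01.prems[of "zrot (t / 2) ** V"] unitary_zrot[of "t / 2"]
    by (simp add: unitary_op_mult bloch_rot_mult unitary_op_left bloch_rot_zrot)
next
  case (givens_word_12 G t)
  then obtain V where "unitary_op V" "bloch_rot V = G" by blast
  then show ?case
    using givens_word_12.prems[of "xrot (t / 2) ** V"] unitary_xrot[of "t / 2"]
    by (simp add: unitary_op_mult bloch_rot_mult unitary_op_left bloch_rot_xrot)
qed

section \<open>Decoupling the correlated part\<close>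

lemma exists_givens_unitary_decoupling:
  assumes "sin (2 * a3) = 0" and "unitary_op R"
    and "ptrE Y = 0" and "ptrS Y = 0" and "adj Y = Y"
  obtains V where "unitary_op V" and "product_of_givens (bloch_rot V)"
    and "ptrE (Omega a1 a2 a3 ** (((R ** V) \<otimes>\<^sub>q mat 1) ** Y ** adj ((R ** V) \<otimes>\<^sub>q mat 1))
               ** adj (Omega a1 a2 a3)) = 0"
proof -
  obtain p q r w where Omega: "Omega a1 a2 a3 = xmat p q r w"
    and xmat_conds: "cnj p * q + cnj q * p = 0" "cnj r * w + cnj w * r = 0"
      "cnj p * p + cnj q * q = cnj r * r + cnj w * w" "cnj p * r = cnj r * p" "cnj q * w = cnj w * q"
    using Omega_eq_xmat[OF assms(1)] by blast
  define C where "C = (\<chi> k l. Re (corr Y k l))"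
  define M where "M G = bloch_rot R ** G ** C" for G
  obtain G where G: "givens_word G" and M: "M G $ 2 $ 0 = 0" "M G $ 2 $ 1 = 0"
    "Re (kappa01 p q r w) * M G $ 0 $ 1 + Re (kappa10 p q r w) * M G $ 1 $ 0 = 0"
    using exists_givens_word_correlation_form[OF bloch_rot_orthogonal[OF assms(2)]]
    unfolding M_def by blast
  obtain V where V: "unitary_op V" "bloch_rot V = G"
    using givens_word_realized[OF G] by blast
  define Z where "Z = ((R ** V) \<otimes>\<^sub>q mat 1) ** Y ** adj ((R ** V) \<otimes>\<^sub>q mat 1)"
  have RV: "unitary_op (R ** V)" using assms(2) V(1) by (rule unitary_op_mult)
  have marginals: "ptrE Z = 0" "ptrS Z = 0"
    unfolding Z_def
    by (simp_all add: ptrE_tensor_conj ptrS_tensor_conj unitary_op_left[OF RV] assms(3,4))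
  have corr_Z: "corr Z i j = of_real (M G $ i $ j)" for i j
    unfolding Z_def corr_tensor_conj_real[OF assms(4,5)] M_def C_def
    by (simp add: bloch_rot_mult unitary_op_left[OF V(1)] V(2))
  have "kappa01 p q r w * corr Z 0 1 + kappa10 p q r w * corr Z 1 0
      = of_real (Re (kappa01 p q r w) * M G $ 0 $ 1 + Re (kappa10 p q r w) * M G $ 1 $ 0)"
    unfolding corr_Z by (subst kappa01_real, subst kappa10_real) simp
  then have "kappa01 p q r w * corr Z 0 1 + kappa10 p q r w * corr Z 1 0 = 0"
    using M(3) by simp
  then have "ptrE (xmat p q r w ** Z ** adj (xmat p q r w)) = 0"
    using marginals xmat_conds M(1,2) corr_Z by (intro ptrE_xmat_conj_eq_0) simp_all
  then show ?thesis
    using that V product_of_givens_givens_word[OF G] by (simp add: Omega Z_def)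
qed

definition locally_product_generated :: "qqop \<Rightarrow> qqop \<Rightarrow> bool" where
  "locally_product_generated U \<rho> \<longleftrightarrow>
     (\<exists>V \<zeta>. unitary_op V \<and> product_of_givens (bloch_rot V) \<and> density \<zeta> \<and>
        ptrE (U ** ((V \<otimes>\<^sub>q mat 1) ** \<rho> ** adj (V \<otimes>\<^sub>q mat 1)) ** adj U)
      = ptrE (U ** ((V ** ptrE \<rho> ** adj V) \<otimes>\<^sub>q \<zeta>) ** adj U))"

lemma ptrE_local_conj:
  assumes "adj L2 ** L2 = mat 1"
  shows "ptrE (((L1 \<otimes>\<^sub>q L2) ** W ** (R1 \<otimes>\<^sub>q R2)) ** X ** adj ((L1 \<otimes>\<^sub>q L2) ** W ** (R1 \<otimes>\<^sub>q R2)))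
       = L1 ** ptrE (W ** ((R1 \<otimes>\<^sub>q R2) ** X ** adj (R1 \<otimes>\<^sub>q R2)) ** adj W) ** adj L1"
proof -
  have "((L1 \<otimes>\<^sub>q L2) ** W ** (R1 \<otimes>\<^sub>q R2)) ** X ** adj ((L1 \<otimes>\<^sub>q L2) ** W ** (R1 \<otimes>\<^sub>q R2))
      = (L1 \<otimes>\<^sub>q L2) ** (W ** ((R1 \<otimes>\<^sub>q R2) ** X ** adj (R1 \<otimes>\<^sub>q R2)) ** adj W) ** adj (L1 \<otimes>\<^sub>q L2)"
    by (simp add: adj_matrix_mult matrix_mul_assoc)
  then show ?thesis by (simp add: ptrE_tensor_conj[OF assms])
qed

lemma exists_givens_unitary_decoupling_local:
  fixes a1 a2 a3 :: real and L1 L2 R1 R2 :: qop and \<gamma> :: qqop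
  assumes "sin (2 * a3) = 0" and "unitary_op L2" and "unitary_op R1" and "unitary_op R2"
    and "ptrE \<gamma> = 0" and "ptrS \<gamma> = 0" and "adj \<gamma> = \<gamma>"
  defines "U \<equiv> (L1 \<otimes>\<^sub>q L2) ** Omega a1 a2 a3 ** (R1 \<otimes>\<^sub>q R2)"
  obtains V where "unitary_op V" and "product_of_givens (bloch_rot V)"
    and "ptrE (U ** ((V \<otimes>\<^sub>q mat 1) ** \<gamma> ** adj (V \<otimes>\<^sub>q mat 1)) ** adj U) = 0"
proof -
  define Y where "Y = (mat 1 \<otimes>\<^sub>q R2) ** \<gamma> ** adj (mat 1 \<otimes>\<^sub>q R2)"
  have "ptrE Y = 0" "ptrS Y = 0" "adj Y = Y"
    unfolding Y_def using assms(5-7) unitary_op_left[OF assms(4)]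
    by (simp_all add: ptrE_tensor_conj ptrS_tensor_conj adj_matrix_mult matrix_mul_assoc)
  then obtain V where V: "unitary_op V" "product_of_givens (bloch_rot V)"
    and decoupled: "ptrE (Omega a1 a2 a3 ** (((R1 ** V) \<otimes>\<^sub>q mat 1) ** Y ** adj ((R1 ** V) \<otimes>\<^sub>q mat 1))
                         ** adj (Omega a1 a2 a3)) = 0"
    using exists_givens_unitary_decoupling[OF assms(1,3)] by blast
  have conj: "A ** (B ** X ** adj B) ** adj A = (A ** B) ** X ** adj (A ** B)" for A B X :: qqop
    by (simp add: adj_matrix_mult matrix_mul_assoc)
  have "(R1 \<otimes>\<^sub>q R2) ** (V \<otimes>\<^sub>q mat 1) = ((R1 ** V) \<otimes>\<^sub>q mat 1) ** (mat 1 \<otimes>\<^sub>q R2)"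
    by (simp add: tensor_matrix_mult)
  then have "(R1 \<otimes>\<^sub>q R2) ** ((V \<otimes>\<^sub>q mat 1) ** \<gamma> ** adj (V \<otimes>\<^sub>q mat 1)) ** adj (R1 \<otimes>\<^sub>q R2)
      = ((R1 ** V) \<otimes>\<^sub>q mat 1) ** Y ** adj ((R1 ** V) \<otimes>\<^sub>q mat 1)"
    by (simp only: Y_def conj)
  then have "ptrE (U ** ((V \<otimes>\<^sub>q mat 1) ** \<gamma> ** adj (V \<otimes>\<^sub>q mat 1)) ** adj U) = 0"
    unfolding U_def ptrE_local_conj[OF unitary_op_left[OF assms(2)]] by (simp add: decoupled)
  with V that show ?thesis by blast
qed

lemma locally_product_generated_Omega:
  assumes "sin (2 * a3) = 0"
    and "unitary_op L2" and "unitary_op R1" and "unitary_op R2" and "density \<rho>"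
  shows "locally_product_generated ((L1 \<otimes>\<^sub>q L2) ** Omega a1 a2 a3 ** (R1 \<otimes>\<^sub>q R2)) \<rho>"
proof -
  define U where "U = (L1 \<otimes>\<^sub>q L2) ** Omega a1 a2 a3 ** (R1 \<otimes>\<^sub>q R2)"
  define \<zeta> where "\<zeta> = ptrS \<rho>"
  define \<gamma> where "\<gamma> = \<rho> - ptrE \<rho> \<otimes>\<^sub>q \<zeta>"
  have "trace \<rho> = 1" using assms(5) by (simp add: density_def)
  then have "ptrE \<gamma> = 0" "ptrS \<gamma> = 0"
    unfolding \<gamma>_def \<zeta>_def by (rule ptrE_ptrS_correlated_part)+
  moreover have "adj \<gamma> = \<gamma>"
    unfolding \<gamma>_def \<zeta>_def by (simp add: adj_diff adj_tensor adj_ptrE adj_ptrS density_adj[OF assms(5)])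
  ultimately obtain V where V: "unitary_op V" "product_of_givens (bloch_rot V)"
    and correlated: "ptrE (U ** ((V \<otimes>\<^sub>q mat 1) ** \<gamma> ** adj (V \<otimes>\<^sub>q mat 1)) ** adj U) = 0"
    using exists_givens_unitary_decoupling_local[OF assms(1-4)] unfolding U_def by blast
  have product: "(V \<otimes>\<^sub>q mat 1) ** (ptrE \<rho> \<otimes>\<^sub>q \<zeta>) ** adj (V \<otimes>\<^sub>q mat 1) = (V ** ptrE \<rho> ** adj V) \<otimes>\<^sub>q \<zeta>"
    by (simp add: adj_tensor tensor_matrix_mult)
  have "ptrE (U ** ((V \<otimes>\<^sub>q mat 1) ** (\<gamma> + ptrE \<rho> \<otimes>\<^sub>q \<zeta>) ** adj (V \<otimes>\<^sub>q mat 1)) ** adj U)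
      = ptrE (U ** ((V ** ptrE \<rho> ** adj V) \<otimes>\<^sub>q \<zeta>) ** adj U)"
    unfolding matrix_add_ldistrib matrix_add_rdistrib ptrE_add correlated product by simp
  moreover have "\<gamma> + ptrE \<rho> \<otimes>\<^sub>q \<zeta> = \<rho>" by (simp add: \<gamma>_def)
  moreover have "density \<zeta>" unfolding \<zeta>_def using assms(5) by (rule density_ptrS)
  ultimately show ?thesis
    unfolding locally_product_generated_def U_def using V by auto
qed

lemma sin_double_Sset: "a \<in> Sset \<Longrightarrow> sin (2 * a) = 0"
  by (auto simp: Sset_def mult.commute[of 2])

lemma locally_product_generated_Omega_Sset:
  assumes "a1 \<in> Sset \<or> a2 \<in> Sset \<or> a3 \<in> Sset"
    and "unitary_op L2" and "unitary_op R1" and "unitary_op R2" and "density \<rho>"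
  shows "locally_product_generated ((L1 \<otimes>\<^sub>q L2) ** Omega a1 a2 a3 ** (R1 \<otimes>\<^sub>q R2)) \<rho>"
proof -
  have base: "locally_product_generated ((L1' \<otimes>\<^sub>q L2') ** Omega b1 b2 b3 ** (R1' \<otimes>\<^sub>q R2')) \<rho>"
    if "b3 \<in> Sset" "unitary_op L2'" "unitary_op R1'" "unitary_op R2'" for b1 b2 b3 L1' L2' R1' R2'
    using locally_product_generated_Omega[OF sin_double_Sset that(2-4) assms(5)] that(1) by blast
  have cycle: "unitary_op (L ** pauli_cycle)" "unitary_op (adj pauli_cycle ** R)"
    if "unitary_op L" "unitary_op R" for L R
    using that unitary_pauli_cycle by (simp_all add: unitary_op_mult unitary_op_adj)
  from assms(1) consider "a3 \<in> Sset" | "a1 \<in> Sset" | "a2 \<in> Sset" by blast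
  then show ?thesis
  proof cases
    case 1
    then show ?thesis using assms(2-4) by (rule base)
  next
    case 2
    then show ?thesis
      unfolding local_Omega_cycle[of L1 L2 a1] using assms(2-4) by (intro base cycle)
  next
    case 3
    then show ?thesis
      unfolding local_Omega_cycle[of L1 L2 a1] local_Omega_cycle[of _ _ a2]
      using assms(2-4) by (intro base cycle)
  qed
qed

theorem theorem1:
  fixes a1 a2 a3 :: real
    and L1 L2 R1 R2 :: "complex^2^2"
    and \<rho> :: "complex^(2 \<times> 2)^(2 \<times> 2)"
  assumes two_param:
      "(a1 \<in> Sset \<and> a2 \<notin> Sset \<and> a3 \<notin> Sset)
     \<or> (a1 \<notin> Sset \<and> a2 \<in> Sset \<and> a3 \<notin> Sset)
     \<or> (a1 \<notin> Sset \<and> a2 \<notin> Sset \<and> a3 \<in> Sset)"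
    and "unitary_op L1" and "unitary_op L2" and "unitary_op R1" and "unitary_op R2"
    and "density \<rho>"
  shows "let U = (L1 \<otimes>\<^sub>q L2) ** Omega a1 a2 a3 ** (R1 \<otimes>\<^sub>q R2) in
         \<exists>V \<zeta>. unitary_op V \<and> product_of_givens (bloch_rot V) \<and> density \<zeta> \<and>
           ptrE (U ** ((V \<otimes>\<^sub>q mat 1) ** \<rho> ** adj (V \<otimes>\<^sub>q mat 1)) ** adj U)
         = ptrE (U ** ((V ** ptrE \<rho> ** adj V) \<otimes>\<^sub>q \<zeta>) ** adj U)"
proof -
  have "a1 \<in> Sset \<or> a2 \<in> Sset \<or> a3 \<in> Sset" using two_param by blast
  from locally_product_generated_Omega_Sset[OF this assms(3-6)] show ?thesis
    unfolding locally_product_generated_def Let_def .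
qed

end
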